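(* Let $\mu>0$, $c>0$, and consider siDCA (described in the context) with tolerance $\varepsilon=0$ for solving $\min_{\mathbf U} f_{\mu,c}(\mathbf U)+\delta_{\mathbb U_+}(\mathbf U)-h_{\mu,c}(\mathbf U)$. Suppose that only finitely many serious steps are performed. Then: (1) If siDCA terminates in finitely many steps, i.e. there exists $\bar k>0$ such that $\mathbf V^{\bar k+1}=\mathbf U^{\bar k}$ and $\Delta^{\bar k+1}=\mathbf 0$, then the stability center $\mathbf U^{\bar k}$ is a stationary point of this problem. (2) If after the $\hat k$-th iteration of siDCA only null steps are performed, then the stability center $\mathbf U^{\hat k+1}$ is a stationary point of this problem.
   Context: Setting. The pair $(\mathbb U,\mathbb U_+)$ is one of: $(\mathbb R^{m\times n},\mathbb R_+^{m\times n})$ (real matrices, entrywise nonnegative matrices); $(\mathbb S^n,\mathbb S_+^n)$ (real symmetric, positive semidefinite); $(\mathbb H^n,\mathbb H_+^n)$ (Hermitian, positive semidefinite Hermitian). $\mathbb U$ is a real inner product space with the Frobenius inner product $\langle\mathbf U,\mathbf V\rangle=\operatorname{Re}\operatorname{tr}(\mathbf V^*\mathbf U)$ and norm $\|\cdot\|_F$. $\mathcal A:\mathbb U\to\mathbb R^N$ is linear, $\boldsymbol b\in\mathbb R^N$, $\ell(\mathbf U)=\frac12\|\mathcal A(\mathbf U)-\boldsymbol b\|^2$. $r,s$ are given positive integers. $\|\mathbf U\|_0$ is the number of nonzero entries, $\|\mathbf U\|_1$ the sum of absolute values of the entries, $\|\mathbf U\|_{(s)}$ the sum of the $s$ largest absolute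 values of entries, $\|\mathbf U\|_*$ the nuclear norm, $\|\mathbf U\|_{*(r)}$ the sum of the $r$ largest singular values. $\tau>0$ is a fixed constant with $\tau\gg\max\{\max_{i,j}|\mathbf U^*_{i,j}|,\sigma_{\max}(\mathbf U^* )\}$ (in particular $\tau$ exceeds this maximum), where $\mathbf U^*$ is a global optimal solution of $\min\{\ell(\mathbf U):\mathbf U\in\mathbb U_+,\operatorname{rank}(\mathbf U)\le r,\|\mathbf U\|_0\le s\}$. Let $\mathbb C_{r,\tau}=\{\mathbf U\in\mathbb U:\operatorname{rank}\mathbf U\le r,\ \sigma_{\max}(\mathbf U)\le\tau\}$ and $\mathbb C_{s,\tau}=\{\mathbf U\in\mathbb U:\|\mathbf U\|_0\le s,\ \max_{i,j}|\mathbf U_{i,j}|\le\tau\}$; $\delta_C$ is the indicator function of $C$. If $\mathbb U_+=\mathbb S_+^n$ or $\mathbb H_+^n$: $g=\delta_{\mathbb C_{s,\tau}}$, $P_1(\mathbf U)=\langle\mathbf U,\mathbf I\rangle$ (which equals $\|\mathbf U\|_*$ on $\mathbb U_+$), $P_2=\|\cdot\|_{*(r)}$. If $\mathbb U_+=\mathbb R_+^{m\times n}$: $g=\delta_{\mathbb C_{r,\tau}}$, $P_1(\mathbf U)=\langle\mathbf U,\mathbf E\rangle$ with $\mathbf E$ the all-ones matrix (which equals $\|\mathbf U\|_1$ on $\mathbb U_+$), $P_2=\|\cdot\|_{(s)}$. $D_{\mu,g}(\mathbf U)=\sup_{\mathbf V\in\operatorname{dom}g}\{\frac1\mu\langle\mathbf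 U,\mathbf V\rangle-\frac1{2\mu}\|\mathbf V\|_F^2-g(\mathbf V)\}$, so that $\frac1{2\mu}\|\mathbf U\|_F^2-D_{\mu,g}(\mathbf U)$ is the Moreau envelope $\inf_{\mathbf V\in\operatorname{dom} g}\{\frac1{2\mu}\|\mathbf V-\mathbf U\|_F^2+g(\mathbf V)\}$ of $g$. Put $f_{\mu,c}(\mathbf U)=\ell(\mathbf U)+\frac1{2\mu}\|\mathbf U\|_F^2+cP_1(\mathbf U)$ (smooth, strongly convex) and $h_{\mu,c}(\mathbf U)=D_{\mu,g}(\mathbf U)+cP_2(\mathbf U)$ (finite-valued convex). A point $\mathbf U\in\mathbb U_+$ is a stationary point of $\min f_{\mu,c}+\delta_{\mathbb U_+}-h_{\mu,c}$ if $(\nabla f_{\mu,c}(\mathbf U)+\partial\delta_{\mathbb U_+}(\mathbf U))\cap\partial h_{\mu,c}(\mathbf U)\ne\emptyset$. Here $\partial$ is the convex subdifferential. siDCA (inexact DCA with sieving strategy). Step 0: given $c>0$, $\mu>0$, tolerance $\varepsilon\ge0$, nonnegative sequence $\epsilon_k\downarrow0$, sieving parameter $\kappa\in(0,1)$; $\mathbf U^0=\mathbf V^0\in\mathbb U_+$, $\mathbf W^0\in\partial h_{\mu,c}(\mathbf U^0)$, $k=0$. Step 1: compute $\mathbf V^{k+1}$ approximately minimizing $G^k_{\mu,c}(\mathbf U)=f_{\mu,c}(\mathbf U)+\delta_{\mathbb U_+}(\mathbf U)-\langle\mathbf U,\mathbf W^k\rangle$, so that there is $\Delta^{k+1}\in\partial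 G^k_{\mu,c}(\mathbf V^{k+1})$ with $\|\Delta^{k+1}\|_F\le\epsilon_{k+1}$. Step 2: if $\|\mathbf V^{k+1}-\mathbf U^k\|_F\le\varepsilon$ and $\|\Delta^{k+1}\|_F\le\varepsilon$, stop. Step 3: if the sieving condition $\|\Delta^{k+1}\|_F<\frac1{2\mu}(1-\kappa)\|\mathbf V^{k+1}-\mathbf U^k\|_F$ holds, set $\mathbf U^{k+1}=\mathbf V^{k+1}$ and choose $\mathbf W^{k+1}\in\partial h_{\mu,c}(\mathbf U^{k+1})$ (a serious step); else set $\mathbf U^{k+1}=\mathbf U^k$, $\mathbf W^{k+1}=\mathbf W^k$ (a null step). Set $k:=k+1$ and go to Step 1. The points $\mathbf U^k$ are called stability centers. *)

theory Defs
  imports "HOL-Analysis.Analysis" "HOL-Computational_Algebra.Polynomial"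
    "HOL-Library.Extended_Nat"
begin

section \<open>Matrices\<close>

definition conj_transpose :: "complex^'n^'m \<Rightarrow> complex^'m^'n" where
  "conj_transpose U = (\<chi> i j. cnj (U $ j $ i))"

text \<open>
  The inner product and the norm of the library types of matrices are the Frobenius ones.
\<close>

lemma inner_matrix_real: "U \<bullet> V = trace (transpose V ** U)"
  for U V :: "real^'n^'m"
  unfolding trace_def transpose_def matrix_matrix_mult_def inner_vec_def
  by (subst sum.swap) (simp add: mult.commute)

lemma inner_matrix_complex: "U \<bullet> V = Re (trace (conj_transpose V ** U))"
  for U V :: "complex^'n^'m"
  unfolding trace_def conj_transpose_def matrix_matrix_mult_def inner_vec_def
  by (subst sum.swap) (simp add: inner_complex_def mult.commute)

lemma inner_vec_complex: "x \<bullet> y = Re (\<Sum>i\<in>UNIV. cnj (x $ i) * y $ i)"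
  for x y :: "complex^'n"
  by (simp add: inner_vec_def inner_complex_def)

definition nonneg_matrices :: "(real^'n^'m) set" where
  "nonneg_matrices = {U. \<forall>i j. 0 \<le> U $ i $ j}"

definition sym_matrices :: "(real^'n^'n) set" where
  "sym_matrices = {U. transpose U = U}"

definition sym_psd_matrices :: "(real^'n^'n) set" where
  "sym_psd_matrices = {U \<in> sym_matrices. \<forall>x. 0 \<le> x \<bullet> (U *v x)}"

definition herm_matrices :: "(complex^'n^'n) set" where
  "herm_matrices = {U. conj_transpose U = U}"

text \<open>
  By \<open>inner_vec_complex\<close> the quadratic form below is the real part of \<open>x\<^sup>* U x\<close>,
  which is a real number for Hermitian \<open>U\<close>.
\<close>

definition herm_psd_matrices :: "(complex^'n^'n) set" where
  "herm_psd_matrices = {U \<in> herm_matrices. \<forall>x. 0 \<le> x \<bullet> (U *v x)}"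

definition nnz :: "'k::zero^'n^'m \<Rightarrow> nat" where
  "nnz U = card {(i, j). U $ i $ j \<noteq> 0}"

definition abs_entries :: "'k::real_normed_vector^'n^'m \<Rightarrow> real multiset" where
  "abs_entries U = image_mset (\<lambda>(i, j). norm (U $ i $ j)) (mset_set UNIV)"

definition max_abs_entry :: "'k::real_normed_vector^'n^'m \<Rightarrow> real" where
  "max_abs_entry U = Max_mset (abs_entries U)"

definition char_pol :: "'k::comm_ring_1^'n^'n \<Rightarrow> 'k poly" where
  "char_pol M = det (\<chi> i j. (if i = j then [:0, 1:] else 0) - [:M $ i $ j:])"

text \<open>
  Square roots of the eigenvalues of the Gram matrix, counted with multiplicity. An
  \<open>m \<times> n\<close> matrix gets \<open>n\<close> of them, so for \<open>m < n\<close> there are \<open>n - m\<close> additional zeros;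
  these affect neither the largest singular value nor sums of largest singular values.
\<close>

definition singular_values :: "real^'n^'m \<Rightarrow> real multiset" where
  "singular_values U = image_mset sqrt (proots (char_pol (transpose U ** U)))"

definition csingular_values :: "complex^'n^'m \<Rightarrow> real multiset" where
  "csingular_values U =
     image_mset (\<lambda>z. sqrt (Re z)) (proots (char_pol (conj_transpose U ** U)))"

text \<open>If \<open>M\<close> has fewer than \<open>k\<close> elements, this is the sum of all of them.\<close>

definition sum_largest :: "nat \<Rightarrow> real multiset \<Rightarrow> real" where
  "sum_largest k M = sum_list (take k (rev (sorted_list_of_multiset M)))"


section \<open>Convex analysis on a subspace\<close>

definition linear_on :: "'a::real_vector set \<Rightarrow> ('a \<Rightarrow> 'b::real_vector) \<Rightarrow> bool" where
  "linear_on S A \<longleftrightarrow>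
     (\<forall>x\<in>S. \<forall>y\<in>S. A (x + y) = A x + A y) \<and> (\<forall>c. \<forall>x\<in>S. A (c *\<^sub>R x) = c *\<^sub>R A x)"

definition convex_indicator :: "'a set \<Rightarrow> 'a \<Rightarrow> ereal" where
  "convex_indicator C x = (if x \<in> C then 0 else \<infinity>)"

definition gradient_on :: "'a::real_inner set \<Rightarrow> ('a \<Rightarrow> real) \<Rightarrow> 'a \<Rightarrow> 'a \<Rightarrow> bool" where
  "gradient_on S f x D \<longleftrightarrow> D \<in> S \<and> (f has_derivative (\<lambda>v. v \<bullet> D)) (at x within S)"

text \<open>
  The subdifferential of a function on the subspace \<open>S\<close>; it is empty outside the effective domain.
\<close>

definition subdifferential :: "'a::real_inner set \<Rightarrow> ('a \<Rightarrow> ereal) \<Rightarrow> 'a \<Rightarrow> 'a set" where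
  "subdifferential S F x =
     {w \<in> S. x \<in> S \<and> \<bar>F x\<bar> \<noteq> \<infinity> \<and> (\<forall>y\<in>S. F x + ereal (w \<bullet> (y - x)) \<le> F y)}"


section \<open>Difference-of-convex problems\<close>

text \<open>
  The problem of minimizing \<open>smooth_part U + convex_indicator feas U - subtracted U\<close>
  over \<open>U \<in> ambient\<close>.
\<close>

record 'a dc_problem =
  ambient :: "'a set"
  feas :: "'a set"
  smooth_part :: "'a \<Rightarrow> real"
  subtracted :: "'a \<Rightarrow> ereal"

definition stationary_point :: "'a::real_inner dc_problem \<Rightarrow> 'a \<Rightarrow> bool" where
  "stationary_point P U \<longleftrightarrow> U \<in> feas P \<and>
     (\<exists>D. gradient_on (ambient P) (smooth_part P) U D \<and>
        (\<lambda>N. D + N) ` subdifferential (ambient P) (convex_indicator (feas P)) U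
          \<inter> subdifferential (ambient P) (subtracted P) U \<noteq> {})"

definition loss :: "('a \<Rightarrow> real^'N) \<Rightarrow> real^'N \<Rightarrow> 'a \<Rightarrow> real" where
  "loss A b U = 1 / 2 * (norm (A U - b))\<^sup>2"

definition smooth_fun ::
  "('a::real_inner \<Rightarrow> real^'N) \<Rightarrow> real^'N \<Rightarrow> real \<Rightarrow> real \<Rightarrow> ('a \<Rightarrow> real) \<Rightarrow> 'a \<Rightarrow> real" where
  "smooth_fun A b \<mu> c P1 U = loss A b U + 1 / (2 * \<mu>) * (norm U)\<^sup>2 + c * P1 U"

definition env_conjugate :: "'a::real_inner set \<Rightarrow> real \<Rightarrow> ('a \<Rightarrow> ereal) \<Rightarrow> 'a \<Rightarrow> ereal" where
  "env_conjugate S \<mu> g U =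
     (SUP V \<in> {V \<in> S. g V < \<infinity>}. ereal (1 / \<mu> * (U \<bullet> V) - 1 / (2 * \<mu>) * (norm V)\<^sup>2) - g V)"

definition subtracted_fun ::
  "'a::real_inner set \<Rightarrow> real \<Rightarrow> real \<Rightarrow> ('a \<Rightarrow> ereal) \<Rightarrow> ('a \<Rightarrow> real) \<Rightarrow> 'a \<Rightarrow> ereal" where
  "subtracted_fun S \<mu> c g P2 U = env_conjugate S \<mu> g U + ereal (c * P2 U)"

definition nonneg_problem ::
  "(real^'n^'m \<Rightarrow> real^'N) \<Rightarrow> real^'N \<Rightarrow> nat \<Rightarrow> nat \<Rightarrow> real \<Rightarrow> real \<Rightarrow> real
     \<Rightarrow> (real^'n^'m) dc_problem" where
  "nonneg_problem A b r s \<tau> \<mu> c =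
     \<lparr> ambient = UNIV,
       feas = nonneg_matrices,
       smooth_part = smooth_fun A b \<mu> c (\<lambda>U. U \<bullet> (\<chi> i j. 1)),
       subtracted = subtracted_fun UNIV \<mu> c
         (convex_indicator {U. rank U \<le> r \<and> Max_mset (singular_values U) \<le> \<tau>})
         (\<lambda>U. sum_largest s (abs_entries U)) \<rparr>"

definition sym_problem ::
  "(real^'n^'n \<Rightarrow> real^'N) \<Rightarrow> real^'N \<Rightarrow> nat \<Rightarrow> nat \<Rightarrow> real \<Rightarrow> real \<Rightarrow> real
     \<Rightarrow> (real^'n^'n) dc_problem" where
  "sym_problem A b r s \<tau> \<mu> c =
     \<lparr> ambient = sym_matrices,
       feas = sym_psd_matrices,
       smooth_part = smooth_fun A b \<mu> c (\<lambda>U. U \<bullet> mat 1),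
       subtracted = subtracted_fun sym_matrices \<mu> c
         (convex_indicator {U \<in> sym_matrices. nnz U \<le> s \<and> max_abs_entry U \<le> \<tau>})
         (\<lambda>U. sum_largest r (singular_values U)) \<rparr>"

definition herm_problem ::
  "(complex^'n^'n \<Rightarrow> real^'N) \<Rightarrow> real^'N \<Rightarrow> nat \<Rightarrow> nat \<Rightarrow> real \<Rightarrow> real \<Rightarrow> real
     \<Rightarrow> (complex^'n^'n) dc_problem" where
  "herm_problem A b r s \<tau> \<mu> c =
     \<lparr> ambient = herm_matrices,
       feas = herm_psd_matrices,
       smooth_part = smooth_fun A b \<mu> c (\<lambda>U. U \<bullet> mat 1),
       subtracted = subtracted_fun herm_matrices \<mu> c
         (convex_indicator {U \<in> herm_matrices. nnz U \<le> s \<and> max_abs_entry U \<le> \<tau>})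
         (\<lambda>U. sum_largest r (csingular_values U)) \<rparr>"


section \<open>The inexact DC algorithm with sieving\<close>

definition subproblem_objective :: "'a::real_inner dc_problem \<Rightarrow> 'a \<Rightarrow> 'a \<Rightarrow> ereal" where
  "subproblem_objective P W U =
     ereal (smooth_part P U) + convex_indicator (feas P) U - ereal (U \<bullet> W)"

definition stopping_test ::
  "real \<Rightarrow> (nat \<Rightarrow> 'a::real_normed_vector) \<Rightarrow> (nat \<Rightarrow> 'a) \<Rightarrow> (nat \<Rightarrow> 'a) \<Rightarrow> nat \<Rightarrow> bool" where
  "stopping_test tol U V \<Delta> k \<longleftrightarrow> norm (V (Suc k) - U k) \<le> tol \<and> norm (\<Delta> (Suc k)) \<le> tol"

definition sieving_condition ::
  "real \<Rightarrow> real \<Rightarrow> (nat \<Rightarrow> 'a::real_normed_vector) \<Rightarrow> (nat \<Rightarrow> 'a) \<Rightarrow> (nat \<Rightarrow> 'a) \<Rightarrow> nat \<Rightarrow> bool" where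
  "sieving_condition \<mu> \<kappa> U V \<Delta> k \<longleftrightarrow>
     norm (\<Delta> (Suc k)) < 1 / (2 * \<mu>) * (1 - \<kappa>) * norm (V (Suc k) - U k)"

text \<open>
  A complete run: \<open>K\<close> is the index of the iteration at which the stopping test succeeds, and
  \<open>K = \<infinity>\<close> if this never happens. The values of the sequences beyond that point are irrelevant.
  Iteration \<open>k\<close> is serious if \<open>k < K\<close> and the sieving condition holds, and null if \<open>k < K\<close> and
  the condition fails.
\<close>

definition siDCA_run ::
  "'a::real_inner dc_problem \<Rightarrow> real \<Rightarrow> real \<Rightarrow> (nat \<Rightarrow> real) \<Rightarrow> real \<Rightarrow> enat
     \<Rightarrow> (nat \<Rightarrow> 'a) \<Rightarrow> (nat \<Rightarrow> 'a) \<Rightarrow> (nat \<Rightarrow> 'a) \<Rightarrow> (nat \<Rightarrow> 'a) \<Rightarrow> bool" where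
  "siDCA_run P \<mu> tol \<epsilon> \<kappa> K U V W \<Delta> \<longleftrightarrow>
     U 0 = V 0 \<and> V 0 \<in> feas P \<and> W 0 \<in> subdifferential (ambient P) (subtracted P) (U 0) \<and>
     (\<forall>k. enat k \<le> K \<longrightarrow>
        \<Delta> (Suc k) \<in> subdifferential (ambient P) (subproblem_objective P (W k)) (V (Suc k)) \<and>
        norm (\<Delta> (Suc k)) \<le> \<epsilon> (Suc k)) \<and>
     (\<forall>k. enat k \<le> K \<longrightarrow> (stopping_test tol U V \<Delta> k \<longleftrightarrow> enat k = K)) \<and>
     (\<forall>k. enat k < K \<longrightarrow>
        (if sieving_condition \<mu> \<kappa> U V \<Delta> k
         then U (Suc k) = V (Suc k) \<and>
              W (Suc k) \<in> subdifferential (ambient P) (subtracted P) (U (Suc k))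
         else U (Suc k) = U k \<and> W (Suc k) = W k))"

end

theory Submission
  imports Defs
begin

text \<open>
  Along null steps the subproblem does not change, so a failing sieving condition
  \<open>\<parallel>\<Delta>\<parallel> \<ge> (1 - \<kappa>) / (2\<mu>) \<parallel>V - U\<parallel>\<close> together with \<open>\<Delta> \<rightarrow> 0\<close> forces the approximate
  minimizers \<open>V\<close> to converge to the stability center. Passing to the limit in their
  subgradient inequalities, the center minimizes its own subproblem exactly, and the first-order
  condition for a smooth function on a convex set is the stationarity condition. A finite
  termination gives the exact minimality directly.
\<close>

section \<open>First-order conditions\<close>

text \<open>Difference quotients within \<open>S\<close> evaluate the derivative only at
  \<open>y - x\<close> with both points in \<open>S\<close>, hence only on \<open>S\<close> itself.
  This permits moving a gradient into \<open>S\<close> without losing differentiability.\<close>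

lemma has_derivative_within_subspace_cong:
  fixes f :: "'a::real_normed_vector \<Rightarrow> 'b::real_normed_vector"
  assumes f: "(f has_derivative L) (at x within S)"
    and S: "subspace S" "x \<in> S" and L': "bounded_linear L'" and eq: "\<And>v. v \<in> S \<Longrightarrow> L v = L' v"
  shows "(f has_derivative L') (at x within S)"
proof -
  have "((\<lambda>y. (1 / norm (y - x)) *\<^sub>R (f y - (f x + L (y - x)))) \<longlongrightarrow> 0) (at x within S)"
    using f by (simp add: has_derivative_within)
  moreover have "L (y - x) = L' (y - x)" if "y \<in> S" for y
    using eq subspace_diff[OF S(1) that S(2)] by blast
  ultimately have "((\<lambda>y. (1 / norm (y - x)) *\<^sub>R (f y - (f x + L' (y - x)))) \<longlongrightarrow> 0) (at x within S)"
    by (subst Lim_cong_within[OF refl refl refl, where g = "\<lambda>y. (1 / norm (y - x)) *\<^sub>R (f y - (f x + L (y - x)))"])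
      auto
  then show ?thesis
    using L' by (simp add: has_derivative_within)
qed

text \<open>On the segment from \<open>x\<close> to \<open>y\<close>, which stays in
  \<open>C\<close>, minimality bounds the one-sided difference quotients at \<open>x\<close> from
  below. The conclusion is phrased so that \<open>w - D\<close> is a normal vector of
  \<open>C\<close> at \<open>x\<close>, that is, a subgradient of the indicator.\<close>

lemma gradient_on_minimum:
  fixes f :: "'a::real_inner \<Rightarrow> real"
  assumes D: "gradient_on S f x D" and C: "convex C" "C \<subseteq> S" "x \<in> C" "y \<in> C"
    and min: "\<And>z. z \<in> C \<Longrightarrow> f x - x \<bullet> w \<le> f z - z \<bullet> w"
  shows "(w - D) \<bullet> (y - x) \<le> 0"
proof -
  define g where "g t = f (x + t *\<^sub>R (y - x))" for t :: real
  have seg: "x + t *\<^sub>R (y - x) \<in> C" if "t \<in> {0..1}" for t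
    using convexD_alt[OF C(1,3,4), of t] that by (simp add: algebra_simps)
  \<comment> \<open>The base point is written with \<open>0 *\<^sub>R (y - x)\<close> so that the
    chain rule applies at parameter 0.\<close>
  have "(f has_derivative (\<lambda>v. v \<bullet> D)) (at (x + 0 *\<^sub>R (y - x)) within (\<lambda>t. x + t *\<^sub>R (y - x)) ` {0..1})"
    using D C(2) seg unfolding gradient_on_def
    by (auto intro!: has_derivative_subset[where s = S and t = "_ ` _"])
  then have "(g has_derivative (\<lambda>t. (t *\<^sub>R (y - x)) \<bullet> D)) (at 0 within {0..1})"
    unfolding g_def by (rule has_derivative_in_compose[rotated]) (auto intro!: derivative_eq_intros)
  then have "(g has_field_derivative (y - x) \<bullet> D) (at 0 within {0..1})"
    unfolding has_field_derivative_def by (rule has_derivative_eq_rhs) auto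
  then have lim: "((\<lambda>t. (g t - g 0) / (t - 0)) \<longlongrightarrow> (y - x) \<bullet> D) (at 0 within {0..1})"
    by (simp add: has_field_derivative_iff)
  have "(y - x) \<bullet> w \<le> (g t - g 0) / (t - 0)" if "t \<in> {0..1}" "t \<noteq> 0" for t
  proof -
    have "t * ((y - x) \<bullet> w) \<le> g t - g 0"
      using min[OF seg[OF that(1)]] by (simp add: g_def inner_add_left)
    then show ?thesis
      using that by (simp add: pos_le_divide_eq mult.commute)
  qed
  then have "\<forall>\<^sub>F t in at 0 within {0..1}. (y - x) \<bullet> w \<le> (g t - g 0) / (t - 0)"
    by (simp add: eventually_at_filter)
  \<comment> \<open>The filter must be nontrivial for the bound to survive in the limit.\<close>
  moreover have "at (0::real) within {0..1} \<noteq> bot"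
    by (simp add: at_within_Icc_at_right)
  ultimately have "(y - x) \<bullet> w \<le> (y - x) \<bullet> D"
    using lim tendsto_lowerbound by blast
  then show ?thesis
    by (simp add: inner_diff_left inner_commute)
qed

text \<open>A map that is linear only on \<open>S\<close> has no adjoint or derivative in the
  ambient type; a globally linear extension has both. The points of \<open>S\<close> where the
  extension agrees with \<open>A\<close> form a subspace containing a basis of
  \<open>S\<close>.\<close>

lemma linear_on_extend:
  fixes A :: "'a::real_vector \<Rightarrow> 'b::real_vector"
  assumes S: "subspace S" and A: "linear_on S A"
  obtains A' where "linear A'" "\<And>x. x \<in> S \<Longrightarrow> A' x = A x"
proof -
  obtain B where B: "B \<subseteq> S" "independent B" "S \<subseteq> span B"
    by (rule basis_exists)
  obtain A' where A': "linear A'" "\<forall>x\<in>B. A' x = A x"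
    using linear_independent_extend[OF B(2)] by blast
  have "A 0 = 0"
    using A subspace_0[OF S] unfolding linear_on_def by (metis scaleR_zero_left)
  then have "subspace {x \<in> S. A' x = A x}"
    using A subspace_0[OF S] subspace_add[OF S] subspace_scale[OF S]
    by (auto simp: subspace_def linear_on_def linear_0[OF A'(1)] linear_add[OF A'(1)]
        linear_scale[OF A'(1)])
  moreover have "B \<subseteq> {x \<in> S. A' x = A x}"
    using B A' by auto
  ultimately have "span B \<subseteq> {x \<in> S. A' x = A x}"
    by (rule span_minimal[rotated])
  then show ?thesis
    using that A'(1) B(3) by blast
qed

lemma ex_gradient_on_smooth_fun:
  fixes A :: "'a::euclidean_space \<Rightarrow> real^'N"
  assumes S: "subspace S" "x \<in> S" and A: "linear_on S A"
  shows "\<exists>D. gradient_on S (smooth_fun A b \<mu> c (\<lambda>U. U \<bullet> E)) x D"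
proof -
  obtain A' where A': "linear A'" "\<And>x. x \<in> S \<Longrightarrow> A' x = A x"
    using linear_on_extend[OF S(1) A] by blast
  \<comment> \<open>\<open>D0\<close> is the gradient, in the whole space, of the function with
    \<open>A\<close> replaced by its extension: one summand each for the loss, the quadratic term
    and the linear term.\<close>
  define D0 where "D0 = adjoint A' (A' x - b) + (1 / \<mu>) *\<^sub>R x + c *\<^sub>R E"
  \<comment> \<open>\<open>D0\<close> may leave \<open>S\<close>, but \<open>gradient_on\<close>
    asks for a gradient in \<open>S\<close>. Its orthogonal projection \<open>D\<close> induces the
    same functional on \<open>S\<close>.\<close>
  obtain D z where D: "D \<in> span S" "\<And>w. w \<in> span S \<Longrightarrow> orthogonal z w" "D0 = D + z"
    using orthogonal_subspace_decomp_exists[of S D0] by blast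
  have bl: "bounded_linear A'"
    using A'(1) by (simp add: linear_conv_bounded_linear)
  have adj: "A' v \<bullet> u = v \<bullet> adjoint A' u" for u v
    using adjoint_works[OF A'(1)] by (simp add: inner_commute)
  have "((\<lambda>y. 1 / 2 * ((A' y - b) \<bullet> (A' y - b)) + 1 / (2 * \<mu>) * (y \<bullet> y) + c * (y \<bullet> E))
      has_derivative (\<lambda>v. v \<bullet> D0)) (at x within S)"
    by (rule has_derivative_eq_rhs, (rule derivative_intros bounded_linear.has_derivative[OF bl])+)
      (simp add: D0_def adj[symmetric] inner_add_right fun_eq_iff inner_commute[of x]
        inner_commute[of "A' x - b"])
  then have "(smooth_fun A b \<mu> c (\<lambda>U. U \<bullet> E) has_derivative (\<lambda>v. v \<bullet> D0)) (at x within S)"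
    using S(2)
    by (rule has_derivative_transform[rotated 2])
      (simp add: smooth_fun_def loss_def power2_norm_eq_inner A')
  then have "(smooth_fun A b \<mu> c (\<lambda>U. U \<bullet> E) has_derivative (\<lambda>v. v \<bullet> D)) (at x within S)"
  proof (rule has_derivative_within_subspace_cong[OF _ S])
    show "v \<bullet> D0 = v \<bullet> D" if "v \<in> S" for v
      using D(2)[OF span_base[OF that]] by (simp add: D(3) inner_add_right orthogonal_def inner_commute)
  qed (rule bounded_linear_inner_left)
  moreover have "D \<in> S"
    using D(1) S(1) span_eq_iff by blast
  ultimately show ?thesis
    by (auto simp: gradient_on_def)
qed

section \<open>Stationarity of stability centers\<close>

text \<open>A subgradient exists only where the objective is finite, which forces feasibility;
  between feasible points the indicator vanishes and the inequality becomes one of real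
  numbers.\<close>

lemma subdifferential_subproblem_objective:
  assumes "d \<in> subdifferential S (subproblem_objective P W) x" "feas P \<subseteq> S"
  shows "x \<in> feas P"
    and "y \<in> feas P \<Longrightarrow> smooth_part P x - x \<bullet> W + d \<bullet> (y - x) \<le> smooth_part P y - y \<bullet> W"
proof -
  show x: "x \<in> feas P"
    using assms(1)
    by (auto simp: subdifferential_def subproblem_objective_def convex_indicator_def split: if_splits)
  show "smooth_part P x - x \<bullet> W + d \<bullet> (y - x) \<le> smooth_part P y - y \<bullet> W" if y: "y \<in> feas P"
  proof -
    have "subproblem_objective P W x + ereal (d \<bullet> (y - x)) \<le> subproblem_objective P W y"
      using assms y by (auto simp: subdifferential_def)
    then show ?thesis
      using x y by (simp add: subproblem_objective_def convex_indicator_def)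
  qed
qed

text \<open>Collects what the three matrix problems share, so that the argument about the algorithm
  is given once.\<close>

locale smooth_dc_problem =
  fixes P :: "'a::euclidean_space dc_problem"
  assumes subspace_ambient: "subspace (ambient P)"
    and feas_subset: "feas P \<subseteq> ambient P"
    and convex_feas: "convex (feas P)"
    and ex_gradient: "x \<in> ambient P \<Longrightarrow> \<exists>D. gradient_on (ambient P) (smooth_part P) x D"
begin

text \<open>The common element of the two sets is \<open>W\<close> itself, split as
  \<open>D + (W - D)\<close> with \<open>W - D\<close> normal to the feasible set at
  \<open>U\<close>.\<close>

lemma stationary_point_if_minimizes_subproblem:
  assumes U: "U \<in> feas P" and W: "W \<in> subdifferential (ambient P) (subtracted P) U"
    and min: "\<And>y. y \<in> feas P \<Longrightarrow> smooth_part P U - U \<bullet> W \<le> smooth_part P y - y \<bullet> W"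
  shows "stationary_point P U"
proof -
  obtain D where D: "gradient_on (ambient P) (smooth_part P) U D"
    using ex_gradient U feas_subset by blast
  have "W \<in> ambient P" "D \<in> ambient P"
    using W D by (auto simp: subdifferential_def gradient_on_def)
  then have "W - D \<in> subdifferential (ambient P) (convex_indicator (feas P)) U"
    using gradient_on_minimum[OF D convex_feas feas_subset U _ min] U feas_subset
      subspace_diff[OF subspace_ambient]
    by (auto simp: subdifferential_def convex_indicator_def)
  then have "D + (W - D) \<in> (\<lambda>N. D + N) ` subdifferential (ambient P) (convex_indicator (feas P)) U"
    by (rule imageI)
  then show ?thesis
    using U W D unfolding stationary_point_def by auto
qed

text \<open>Invariant of the run: a serious step moves to \<open>V (Suc k)\<close>, feasible because
  the subproblem has a subgradient there, and picks a fresh \<open>W\<close>; a null step inherits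
  both.\<close>

lemma siDCA_run_center:
  assumes run: "siDCA_run P \<mu> tol \<epsilon> \<kappa> K U V W \<Delta>" and "enat k \<le> K"
  shows "U k \<in> feas P \<and> W k \<in> subdifferential (ambient P) (subtracted P) (U k)"
  using assms(2)
proof (induction k)
  case 0
  then show ?case
    using run unfolding siDCA_run_def by metis
next
  case (Suc k)
  then have k: "enat k < K"
    by (simp add: Suc_ile_eq)
  then have "V (Suc k) \<in> feas P"
    using run feas_subset unfolding siDCA_run_def
    by (meson order_less_imp_le subdifferential_subproblem_objective(1))
  then show ?case
    using run k Suc.IH unfolding siDCA_run_def by (metis order_less_imp_le)
qed

text \<open>With \<open>\<Delta> (Suc k) = 0\<close> the error term in the subgradient inequality
  disappears, so the center minimizes its own subproblem.\<close>

lemma siDCA_run_stop_stationary: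
  assumes run: "siDCA_run P \<mu> tol \<epsilon> \<kappa> K U V W \<Delta>" and k: "enat k \<le> K"
    and stop: "V (Suc k) = U k" "\<Delta> (Suc k) = 0"
  shows "stationary_point P (U k)"
proof (rule stationary_point_if_minimizes_subproblem)
  show "U k \<in> feas P" "W k \<in> subdifferential (ambient P) (subtracted P) (U k)"
    using siDCA_run_center[OF run k] by auto
  have "\<Delta> (Suc k) \<in> subdifferential (ambient P) (subproblem_objective P (W k)) (V (Suc k))"
    using run k by (simp add: siDCA_run_def)
  from subdifferential_subproblem_objective(2)[OF this feas_subset]
  show "smooth_part P (U k) - U k \<bullet> W k \<le> smooth_part P y - y \<bullet> W k" if "y \<in> feas P" for y
    using that by (simp add: stop)
qed

text \<open>Iteration \<open>khat\<close> itself may be serious; the center is frozen from index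
  \<open>Suc khat\<close> on. The tail either ends at a successful stopping test or is infinite, and
  only the second case needs a limit.\<close>

lemma siDCA_run_null_tail_stationary:
  assumes run: "siDCA_run P \<mu> 0 \<epsilon> \<kappa> K U V W \<Delta>" and khat: "enat khat < K"
    and null: "\<forall>k>khat. enat k < K \<longrightarrow> \<not> sieving_condition \<mu> \<kappa> U V \<Delta> k"
    and \<mu>: "\<mu> > 0" and \<kappa>: "\<kappa> < 1" and \<epsilon>: "\<epsilon> \<longlonglongrightarrow> 0"
  shows "stationary_point P (U (Suc khat))"
proof -
  define U' W' where "U' = U (Suc khat)" and "W' = W (Suc khat)"
  \<comment> \<open>The guard includes \<open>K\<close>, since the center with index
    \<open>K\<close> is still produced by the preceding iteration; later values are
    arbitrary.\<close>
  have const: "enat k \<le> K \<longrightarrow> U k = U' \<and> W k = W'" if "Suc khat \<le> k" for k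
    using that
  proof (induction k rule: dec_induct)
    case base
    then show ?case by (simp add: U'_def W'_def)
  next
    case (step k)
    show ?case
    proof
      assume "enat (Suc k) \<le> K"
      then have k: "enat k < K"
        by (simp add: Suc_ile_eq)
      moreover have "\<not> sieving_condition \<mu> \<kappa> U V \<Delta> k"
        using null step.hyps k by simp
      ultimately show "U (Suc k) = U' \<and> W (Suc k) = W'"
        using run step.IH unfolding siDCA_run_def by (metis order_less_imp_le)
    qed
  qed
  show ?thesis
  proof (cases K)
    case (enat kbar)
    then have "stopping_test 0 U V \<Delta> kbar"
      using run unfolding siDCA_run_def by blast
    \<comment> \<open>Tolerance 0 turns both bounds of the test into equalities.\<close>
    then have "V (Suc kbar) = U kbar" "\<Delta> (Suc kbar) = 0"
      by (simp_all add: stopping_test_def)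
    then have "stationary_point P (U kbar)"
      using siDCA_run_stop_stationary[OF run] enat by simp
    moreover have "U kbar = U'"
      using const[of kbar] enat khat by (simp add: Suc_le_eq)
    ultimately show ?thesis
      by (simp add: U'_def)
  next
    case infinity
    have center: "U' \<in> feas P" "W' \<in> subdifferential (ambient P) (subtracted P) U'"
      using siDCA_run_center[OF run, of "Suc khat"] infinity by (simp_all add: U'_def W'_def)
    have sub: "\<Delta> (Suc k) \<in> subdifferential (ambient P) (subproblem_objective P W') (V (Suc k))"
      if "Suc khat \<le> k" for k
    proof -
      have "\<Delta> (Suc k) \<in> subdifferential (ambient P) (subproblem_objective P (W k)) (V (Suc k))"
        using run infinity by (simp add: siDCA_run_def)
      then show ?thesis
        using const[OF that] infinity by simp
    qed
    have "norm (\<Delta> (Suc k)) \<le> \<epsilon> (Suc k)" for k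
      using run infinity by (simp add: siDCA_run_def)
    then have \<Delta>: "(\<lambda>k. \<Delta> (Suc k)) \<longlonglongrightarrow> 0"
      by (intro Lim_null_comparison[OF _ LIMSEQ_Suc[OF \<epsilon>]]) simp
    \<comment> \<open>The failed sieving condition solved for the distance to the center;
      \<open>\<mu> > 0\<close> and \<open>\<kappa> < 1\<close> make the factor positive.\<close>
    have "norm (V (Suc k) - U') \<le> 2 * \<mu> / (1 - \<kappa>) * norm (\<Delta> (Suc k))" if "Suc khat \<le> k" for k
    proof -
      have "1 / (2 * \<mu>) * (1 - \<kappa>) * norm (V (Suc k) - U') \<le> norm (\<Delta> (Suc k))"
        using null[rule_format, of k] infinity that const[OF that]
        by (simp add: sieving_condition_def not_less)
      then show ?thesis
        using \<mu> \<kappa> by (simp add: field_simps)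
    qed
    then have "\<forall>\<^sub>F k in sequentially. norm (V (Suc k) - U') \<le> 2 * \<mu> / (1 - \<kappa>) * norm (\<Delta> (Suc k))"
      by (auto simp: eventually_sequentially)
    moreover have "(\<lambda>k. 2 * \<mu> / (1 - \<kappa>) * norm (\<Delta> (Suc k))) \<longlonglongrightarrow> 0"
      by (intro tendsto_mult_right_zero tendsto_norm_zero \<Delta>)
    ultimately have "(\<lambda>k. V (Suc k) - U') \<longlonglongrightarrow> 0"
      by (rule Lim_null_comparison)
    then have V: "(\<lambda>k. V (Suc k)) \<longlonglongrightarrow> U'"
      by (simp add: LIM_zero_iff)
    obtain D where "gradient_on (ambient P) (smooth_part P) U' D"
      using ex_gradient center(1) feas_subset by blast
    \<comment> \<open>Differentiability is known only within the ambient subspace, so continuity is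
      too; the iterates must therefore be shown to lie there before taking limits.\<close>
    then have cont: "continuous (at U' within ambient P) (smooth_part P)"
      unfolding gradient_on_def by (blast intro: has_derivative_continuous)
    have "\<forall>\<^sub>F k in sequentially. V (Suc k) \<in> ambient P"
      using subdifferential_subproblem_objective(1)[OF sub feas_subset] feas_subset
      by (auto simp: eventually_sequentially)
    then have f: "(\<lambda>k. smooth_part P (V (Suc k))) \<longlonglongrightarrow> smooth_part P U'"
      by (rule continuous_within_tendsto_compose[OF cont _ V])
    have "smooth_part P U' - U' \<bullet> W' \<le> smooth_part P y - y \<bullet> W'" if y: "y \<in> feas P" for y
    proof -
      \<comment> \<open>The error term vanishes in the limit because \<open>\<Delta>\<close> tends
        to 0 while \<open>y - V (Suc k)\<close> converges.\<close>
      have "(\<lambda>k. smooth_part P (V (Suc k)) - V (Suc k) \<bullet> W' + \<Delta> (Suc k) \<bullet> (y - V (Suc k)))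
          \<longlonglongrightarrow> smooth_part P U' - U' \<bullet> W' + 0 \<bullet> (y - U')"
        by (intro tendsto_intros f V \<Delta>)
      moreover have "\<forall>\<^sub>F k in sequentially. smooth_part P (V (Suc k)) - V (Suc k) \<bullet> W'
          + \<Delta> (Suc k) \<bullet> (y - V (Suc k)) \<le> smooth_part P y - y \<bullet> W'"
        using subdifferential_subproblem_objective(2)[OF sub feas_subset y]
        by (auto simp: eventually_sequentially)
      ultimately have "smooth_part P U' - U' \<bullet> W' + 0 \<bullet> (y - U') \<le> smooth_part P y - y \<bullet> W'"
        by (rule tendsto_upperbound) simp
      then show ?thesis
        by simp
    qed
    then show ?thesis
      using stationary_point_if_minimizes_subproblem center by (simp add: U'_def)
  qed
qed

lemma siDCA_run_stationary:
  assumes run: "siDCA_run P \<mu> 0 \<epsilon> \<kappa> K U V W \<Delta>" and "\<mu> > 0" "\<kappa> < 1" "\<epsilon> \<longlonglongrightarrow> 0"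
  shows "(\<forall>kbar>0. K = enat kbar \<and> V (Suc kbar) = U kbar \<and> \<Delta> (Suc kbar) = 0 \<longrightarrow>
       stationary_point P (U kbar)) \<and>
    (\<forall>khat. enat khat < K \<and> (\<forall>k>khat. enat k < K \<longrightarrow> \<not> sieving_condition \<mu> \<kappa> U V \<Delta> k) \<longrightarrow>
       stationary_point P (U (Suc khat)))"
proof (intro conjI allI impI; elim conjE)
  show "stationary_point P (U kbar)"
    if "K = enat kbar" "V (Suc kbar) = U kbar" "\<Delta> (Suc kbar) = 0" for kbar
    using siDCA_run_stop_stationary[OF run _ that(2,3)] that(1) by simp
  show "stationary_point P (U (Suc khat))"
    if "enat khat < K" "\<forall>k>khat. enat k < K \<longrightarrow> \<not> sieving_condition \<mu> \<kappa> U V \<Delta> k" for khat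
    using siDCA_run_null_tail_stationary[OF run that] assms by simp
qed

end

section \<open>The three matrix problems\<close>

text \<open>For each fixed \<open>x\<close> the form is linear in \<open>U\<close>, so its
  nonnegativity survives convex combinations. The general \<open>F\<close> serves real and complex
  matrices alike.\<close>

lemma convex_nonneg_quadratic_form:
  fixes F :: "'a::real_vector \<Rightarrow> 'b::real_inner \<Rightarrow> 'b"
  assumes "convex S" and "\<And>x. linear (\<lambda>U. F U x)"
  shows "convex {U \<in> S. \<forall>x. 0 \<le> x \<bullet> F U x}"
  using assms(1)
  by (auto simp: convex_def linear_add[OF assms(2)] linear_scale[OF assms(2)] inner_add_right)

lemma linear_matrix_vector_mult_left: "linear (\<lambda>U :: 'k::real_algebra_1^'n^'m. U *v x)"
  by (auto intro!: linearI simp: vec_eq_iff matrix_vector_mult_def algebra_simps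
      sum.distrib scaleR_sum_right)

lemma subspace_sym_matrices: "subspace sym_matrices"
  by (auto simp: subspace_def sym_matrices_def transpose_def vec_eq_iff)

text \<open>This is a subspace over the reals: multiplication by the imaginary unit does not
  preserve Hermitian matrices.\<close>

lemma subspace_herm_matrices: "subspace herm_matrices"
  by (auto simp: subspace_def herm_matrices_def conj_transpose_def vec_eq_iff)

lemma smooth_dc_problem_nonneg_problem:
  "linear_on UNIV A \<Longrightarrow> smooth_dc_problem (nonneg_problem A b r s \<tau> \<mu> c)"
  by standard (auto simp: nonneg_problem_def nonneg_matrices_def convex_def ex_gradient_on_smooth_fun)

lemma smooth_dc_problem_sym_problem:
  "linear_on sym_matrices A \<Longrightarrow> smooth_dc_problem (sym_problem A b r s \<tau> \<mu> c)"
  using convex_nonneg_quadratic_form[OF subspace_imp_convex[OF subspace_sym_matrices]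
      linear_matrix_vector_mult_left]
  by unfold_locales
    (auto simp: sym_problem_def sym_psd_matrices_def subspace_sym_matrices ex_gradient_on_smooth_fun)

lemma smooth_dc_problem_herm_problem:
  "linear_on herm_matrices A \<Longrightarrow> smooth_dc_problem (herm_problem A b r s \<tau> \<mu> c)"
  using convex_nonneg_quadratic_form[OF subspace_imp_convex[OF subspace_herm_matrices]
      linear_matrix_vector_mult_left]
  by unfold_locales
    (auto simp: herm_problem_def herm_psd_matrices_def subspace_herm_matrices ex_gradient_on_smooth_fun)

theorem theorem9:
  fixes \<mu> c \<tau> \<kappa> :: real and r s :: nat and \<epsilon> :: "nat \<Rightarrow> real"
  assumes "\<mu> > 0" and "c > 0" and "\<tau> > 0" and "r > 0" and "s > 0"
    and "0 < \<kappa>" and "\<kappa> < 1"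
    and "\<And>k. 0 \<le> \<epsilon> k" and "decseq \<epsilon>" and "\<epsilon> \<longlonglongrightarrow> 0"
  shows "(\<forall>(A :: real^'n^'m \<Rightarrow> real^'N) b Ustar K U V W \<Delta>.
        linear_on UNIV A \<longrightarrow>
        is_arg_min (loss A b) (\<lambda>X. X \<in> nonneg_matrices \<and> rank X \<le> r \<and> nnz X \<le> s) Ustar \<longrightarrow>
        \<tau> > max (max_abs_entry Ustar) (Max_mset (singular_values Ustar)) \<longrightarrow>
        siDCA_run (nonneg_problem A b r s \<tau> \<mu> c) \<mu> 0 \<epsilon> \<kappa> K U V W \<Delta> \<longrightarrow>
        finite {k. enat k < K \<and> sieving_condition \<mu> \<kappa> U V \<Delta> k} \<longrightarrow>
        (\<forall>kbar>0. K = enat kbar \<and> V (Suc kbar) = U kbar \<and> \<Delta> (Suc kbar) = 0 \<longrightarrow>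
           stationary_point (nonneg_problem A b r s \<tau> \<mu> c) (U kbar)) \<and>
        (\<forall>khat. enat khat < K \<and>
             (\<forall>k>khat. enat k < K \<longrightarrow> \<not> sieving_condition \<mu> \<kappa> U V \<Delta> k) \<longrightarrow>
           stationary_point (nonneg_problem A b r s \<tau> \<mu> c) (U (Suc khat)))) \<and>
    (\<forall>(A :: real^'n^'n \<Rightarrow> real^'N) b Ustar K U V W \<Delta>.
        linear_on sym_matrices A \<longrightarrow>
        is_arg_min (loss A b) (\<lambda>X. X \<in> sym_psd_matrices \<and> rank X \<le> r \<and> nnz X \<le> s) Ustar \<longrightarrow>
        \<tau> > max (max_abs_entry Ustar) (Max_mset (singular_values Ustar)) \<longrightarrow>
        siDCA_run (sym_problem A b r s \<tau> \<mu> c) \<mu> 0 \<epsilon> \<kappa> K U V W \<Delta> \<longrightarrow>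
        finite {k. enat k < K \<and> sieving_condition \<mu> \<kappa> U V \<Delta> k} \<longrightarrow>
        (\<forall>kbar>0. K = enat kbar \<and> V (Suc kbar) = U kbar \<and> \<Delta> (Suc kbar) = 0 \<longrightarrow>
           stationary_point (sym_problem A b r s \<tau> \<mu> c) (U kbar)) \<and>
        (\<forall>khat. enat khat < K \<and>
             (\<forall>k>khat. enat k < K \<longrightarrow> \<not> sieving_condition \<mu> \<kappa> U V \<Delta> k) \<longrightarrow>
           stationary_point (sym_problem A b r s \<tau> \<mu> c) (U (Suc khat)))) \<and>
    (\<forall>(A :: complex^'n^'n \<Rightarrow> real^'N) b Ustar K U V W \<Delta>.
        linear_on herm_matrices A \<longrightarrow>
        is_arg_min (loss A b) (\<lambda>X. X \<in> herm_psd_matrices \<and> rank X \<le> r \<and> nnz X \<le> s) Ustar \<longrightarrow>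
        \<tau> > max (max_abs_entry Ustar) (Max_mset (csingular_values Ustar)) \<longrightarrow>
        siDCA_run (herm_problem A b r s \<tau> \<mu> c) \<mu> 0 \<epsilon> \<kappa> K U V W \<Delta> \<longrightarrow>
        finite {k. enat k < K \<and> sieving_condition \<mu> \<kappa> U V \<Delta> k} \<longrightarrow>
        (\<forall>kbar>0. K = enat kbar \<and> V (Suc kbar) = U kbar \<and> \<Delta> (Suc kbar) = 0 \<longrightarrow>
           stationary_point (herm_problem A b r s \<tau> \<mu> c) (U kbar)) \<and>
        (\<forall>khat. enat khat < K \<and>
             (\<forall>k>khat. enat k < K \<longrightarrow> \<not> sieving_condition \<mu> \<kappa> U V \<Delta> k) \<longrightarrow>
           stationary_point (herm_problem A b r s \<tau> \<mu> c) (U (Suc khat))))"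
proof -
  \<comment> \<open>The facts supplied are \<open>\<mu> > 0\<close>, \<open>\<kappa> < 1\<close> and
    the convergence of \<open>\<epsilon>\<close> to 0. The two open premises are the locale
    instance, obtained from linearity of \<open>A\<close>, and the run.\<close>
  note stationary = smooth_dc_problem.siDCA_run_stationary[OF _ _ assms(1,7,10)]
  show ?thesis
    \<comment> \<open>Stripping quantifiers and implications stops at the conjunction of the two
      claims, which is exactly the conclusion of \<open>stationary\<close>.\<close>
    apply (rule conjI, (rule allI impI)+)
     apply (drule (1) stationary[OF smooth_dc_problem_nonneg_problem], assumption)
    apply (rule conjI; (rule allI impI)+)
     apply (drule (1) stationary[OF smooth_dc_problem_sym_problem], assumption)
    apply (drule (1) stationary[OF smooth_dc_problem_herm_problem], assumption)
    done
qed

end
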